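(* Consider the two-person zero-sum risk-sensitive average stochastic game with finite state and action spaces described in the context. Assume the irreducibility condition: for every pair of deterministic stationary policies $(f,g)\in\Pi_1^{sd}\times\Pi_2^{sd}$, the Markov chain $\{X_n,n\in\mathbb{N}\}$ is irreducible under $(f,g)$. Let $\lambda_*=\lim_{n\to\infty}\|\mathcal{L}^n\mathbf{1}\|^{1/n}$, and let $h^*:E\to(0,\infty)$ be a function with $\lambda_*h^*=\mathcal{L}h^*$ (under the irreducibility condition this limit and such a function exist). Given any $\varepsilon\ge0$, if a function $h$ on $E$ satisfies $h\le h^*\le e^{\theta\varepsilon}h$ (pointwise), then each mini-max selector $(\varphi_h,\psi_h)\in\Pi_1^s\times\Pi_2^s$ of $h$ is an $\varepsilon$-saddle point.
   Context: Game data: $\theta\in(0,\infty)$ is a risk-sensitivity parameter; $E$ (states), $A$, $B$ (actions of players 1 and 2) are finite nonempty sets; for each $i\in E$, $A(i)\subset A$ and $B(i)\subset B$ are the nonempty sets of admissible actions; $\mathbb{K}:=\{(i,a,b): i\in E,a\in A(i),b\in B(i)\}$; $P(\cdot|i,a,b)$ is a probability distribution on $E$ for each $(i,a,b)\in\mathbb{K}$; $c:\mathbb{K}\to[0,\infty)$ is the cost to player 1 and reward to player 2 (assumed nonnegative). $\mathbb{N}=\{0,1,2,\ldots\}$. Policies: Let $H_0=E$, $H_n=\mathbb{K}^n\times E$ for $n\ge1$. A (randomized history-dependent) policy of player 1 is a sequence $\pi=\{\pi_n,n\in\mathbb{N}\}$ of stochastic kernels $\pi_n$ on $A$ given $H_n$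 with $\pi_n(A(i_n)|h_n)=1$ for all $h_n=(i_0,a_0,b_0,\ldots,i_{n-1},a_{n-1},b_{n-1},i_n)\in H_n$. It is stationary if there is a stochastic kernel $\varphi$ on $A$ given $E$ with $\pi_n(\cdot|h_n)=\varphi(\cdot|i_n)$ for all $n,h_n$ (then $\pi$ is written $\varphi$), and deterministic stationary if moreover $\varphi(\cdot|i)=\delta_{f(i)}$ for a map $f:E\to A$ (then written $f$). The sets of all, stationary, and deterministic stationary policies of player 1 are $\Pi_1,\Pi_1^s,\Pi_1^{sd}$; $\Pi_2,\Pi_2^s,\Pi_2^{sd}$ are defined analogously for player 2 with $B,B(i)$. For $i\in E$, $(\pi,\sigma)\in\Pi_1\times\Pi_2$, $\mathbb{P}_i^{\pi,\sigma}$ is the unique probability measure on $(E\times A\times B)^\infty$ with coordinate processes $X_n,A_n,B_n$ such that $X_0=i$ a.s.; given the history $h_n$ up to time $n$, $A_n$ and $B_n$ are independent with laws $\pi_n(\cdot|h_n)$, $\sigma_n(\cdot|h_n)$; and given $h_n,a_n,b_n$, $X_{n+1}$ has law $P(\cdot|i_n,a_n,b_n)$. $\mathbb{E}_i^{\pi,\sigma}$ is its expectation. Irreducible means: for all $i,j\in E$ there is $n\ge1$ with $\mathbb{P}_i^{f,g}(X_n=j)>0$. Criterion: $J(i,\pi,\sigma):=\limsup_{n\to\infty}\frac{1}{\theta n}\ln\mathbb{E}_i^{\pi,\sigma}\big[e^{\theta\sum_{k=0}^{n-1}c(X_k,A_k,B_k)}\big]$. The value exists if $\inf_{\pi\in\Pi_1}\sup_{\sigma\in\Pi_2}J(i,\pi,\sigma)=\sup_{\sigma\in\Pi_2}\inf_{\pi\in\Pi_1}J(i,\pi,\sigma)$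 for all $i\in E$; the common function is the value $J^*(i)$. (Under the irreducibility condition the value exists and $J^*(i)=\theta^{-1}\ln\lambda_*$ for all $i$.) A pair $(\pi^\varepsilon,\sigma^\varepsilon)\in\Pi_1\times\Pi_2$ is an $\varepsilon$-saddle point if $J(i,\pi^\varepsilon,\sigma)\le J^*(i)+\varepsilon$ for all $i\in E,\sigma\in\Pi_2$, and $J(i,\pi,\sigma^\varepsilon)\ge J^*(i)-\varepsilon$ for all $i\in E,\pi\in\Pi_1$. Operator: $\mathcal{P}(A(i)),\mathcal{P}(B(i))$ are the sets of probability measures on $A(i),B(i)$. For $h:E\to[0,\infty)$, $$\mathcal{L}^{\mu,\nu}h(i):=\sum_{a\in A(i)}\sum_{b\in B(i)}\sum_{j\in E}e^{\theta c(i,a,b)}h(j)P(j|i,a,b)\mu(a)\nu(b),\qquad \mathcal{L}h(i):=\inf_{\mu\in\mathcal{P}(A(i))}\sup_{\nu\in\mathcal{P}(B(i))}\mathcal{L}^{\mu,\nu}h(i),$$ $\mathcal{L}^0h=h$, $\mathcal{L}^nh=\mathcal{L}(\mathcal{L}^{n-1}h)$; $\|h\|:=\max_{i\in E}|h(i)|$; $\mathbf{1}$ is the constant function one on $E$. Mini-max selector: $(\varphi,\psi)\in\Pi_1^s\times\Pi_2^s$ is a mini-max selector of $h:E\to[0,\infty)$ if for all $i\in E$ $$\mathcal{L}h(i)=\sup_{\nu\in\mathcal{P}(B(i))}\mathcal{L}^{\varphi(\cdot|i),\nu}h(i)=\inf_{\mu\in\mathcal{P}(A(i))}\mathcal{L}^{\mu,\psi(\cdot|i)}h(i)=\mathcal{L}^{\varphi(\cdot|i),\psi(\cdot|i)}h(i).$$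 *)

theory Defs
  imports "HOL-Probability.Probability"
begin

section \<open>Game data\<close>

text \<open>
  The finite nonempty sets of states and actions are types of class \<open>finite\<close>. The transition law
  and the cost are total functions; their values outside the set \<open>adm\<close> of admissible triples
  are irrelevant, since under policies such triples have probability zero.
\<close>

record ('s, 'a, 'b) rs_game =
  theta :: real
  acts1 :: "'s \<Rightarrow> 'a set"
  acts2 :: "'s \<Rightarrow> 'b set"
  trans_law :: "'s \<Rightarrow> 'a \<Rightarrow> 'b \<Rightarrow> 's pmf"
  cost :: "'s \<Rightarrow> 'a \<Rightarrow> 'b \<Rightarrow> real"

definition adm :: "('s, 'a, 'b) rs_game \<Rightarrow> ('s \<times> 'a \<times> 'b) set" where
  "adm G = {(i, a, b). a \<in> acts1 G i \<and> b \<in> acts2 G i}"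

definition valid_game :: "('s::finite, 'a::finite, 'b::finite) rs_game \<Rightarrow> bool" where
  "valid_game G \<longleftrightarrow>
     0 < theta G \<and>
     (\<forall>i. acts1 G i \<noteq> {}) \<and> (\<forall>i. acts2 G i \<noteq> {}) \<and>
     (\<forall>(i, a, b) \<in> adm G. 0 \<le> cost G i a b)"

section \<open>Policies\<close>

text \<open>
  The history \<open>(i\<^sub>0, a\<^sub>0, b\<^sub>0, \<dots>, i\<^sub>n\<^sub>-\<^sub>1, a\<^sub>n\<^sub>-\<^sub>1, b\<^sub>n\<^sub>-\<^sub>1, i\<^sub>n)\<close> is the pair of the list of the
  first \<open>n\<close> triples, in chronological order, and the current state \<open>i\<^sub>n\<close>. The last type
  parameter of \<open>policy\<close> is the action type of the player in question.
\<close>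

definition histories :: "('s, 'a, 'b) rs_game \<Rightarrow> nat \<Rightarrow> (('s \<times> 'a \<times> 'b) list \<times> 's) set" where
  "histories G n = {(hs, i). length hs = n \<and> set hs \<subseteq> adm G}"

type_synonym ('s, 'a, 'b, 'u) policy = "nat \<Rightarrow> ('s \<times> 'a \<times> 'b) list \<Rightarrow> 's \<Rightarrow> 'u pmf"

definition policies ::
    "('s, 'a, 'b) rs_game \<Rightarrow> ('s \<Rightarrow> 'u set) \<Rightarrow> ('s, 'a, 'b, 'u) policy set" where
  "policies G U = {\<pi>. \<forall>n. \<forall>(hs, i) \<in> histories G n. set_pmf (\<pi> n hs i) \<subseteq> U i}"

abbreviation policies1 :: "('s, 'a, 'b) rs_game \<Rightarrow> ('s, 'a, 'b, 'a) policy set" where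
  "policies1 G \<equiv> policies G (acts1 G)"

abbreviation policies2 :: "('s, 'a, 'b) rs_game \<Rightarrow> ('s, 'a, 'b, 'b) policy set" where
  "policies2 G \<equiv> policies G (acts2 G)"

definition probs_on :: "'u set \<Rightarrow> 'u pmf set" where
  "probs_on S = {\<mu>. set_pmf \<mu> \<subseteq> S}"

text \<open>
  Stationary policies are represented by the kernel \<open>\<phi>\<close>, deterministic stationary ones by the
  selector \<open>f\<close>; the functions \<open>stationary\<close> and \<open>deterministic\<close> give the policy they induce.
\<close>

definition stationary_kernels :: "('s \<Rightarrow> 'u set) \<Rightarrow> ('s \<Rightarrow> 'u pmf) set" where
  "stationary_kernels U = {\<phi>. \<forall>i. \<phi> i \<in> probs_on (U i)}"

definition stationary :: "('s \<Rightarrow> 'u pmf) \<Rightarrow> ('s, 'a, 'b, 'u) policy" where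
  "stationary \<phi> = (\<lambda>n hs i. \<phi> i)"

definition selectors :: "('s \<Rightarrow> 'u set) \<Rightarrow> ('s \<Rightarrow> 'u) set" where
  "selectors U = {f. \<forall>i. f i \<in> U i}"

definition deterministic :: "('s \<Rightarrow> 'u) \<Rightarrow> ('s, 'a, 'b, 'u) policy" where
  "deterministic f = stationary (\<lambda>i. return_pmf (f i))"

section \<open>The law of the controlled process\<close>

text \<open>
  A path is a sequence of triples \<open>(X\<^sub>n, A\<^sub>n, B\<^sub>n)\<close>. The conditional law of the \<open>n\<close>-th triple, given
  the first \<open>n\<close> triples of the path \<open>\<omega>\<close>, is the following; \<open>path_measure\<close> is the measure which
  the theorem of Ionescu Tulcea assigns to these conditional laws.
\<close>

definition step_law :: "('s, 'a, 'b) rs_game \<Rightarrow> ('s, 'a, 'b, 'a) policy \<Rightarrow> ('s, 'a, 'b, 'b) policy \<Rightarrow>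
    's \<Rightarrow> nat \<Rightarrow> (nat \<Rightarrow> 's \<times> 'a \<times> 'b) \<Rightarrow> ('s \<times> 'a \<times> 'b) pmf" where
  "step_law G \<pi> \<sigma> i n \<omega> =
     bind_pmf (case n of 0 \<Rightarrow> return_pmf i | Suc m \<Rightarrow> (case \<omega> m of (x, a, b) \<Rightarrow> trans_law G x a b))
       (\<lambda>x. map_pmf (\<lambda>ab. (x, ab))
              (pair_pmf (\<pi> n (map \<omega> [0..<n]) x) (\<sigma> n (map \<omega> [0..<n]) x)))"

definition path_measure :: "('s::finite, 'a::finite, 'b::finite) rs_game \<Rightarrow>
    ('s, 'a, 'b, 'a) policy \<Rightarrow> ('s, 'a, 'b, 'b) policy \<Rightarrow> 's \<Rightarrow> (nat \<Rightarrow> 's \<times> 'a \<times> 'b) measure" where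
  "path_measure G \<pi> \<sigma> i =
     projective_family.lim UNIV
       (Ionescu_Tulcea.CI (\<lambda>n \<omega>. measure_pmf (step_law G \<pi> \<sigma> i n \<omega>)) (\<lambda>_. count_space UNIV))
       (\<lambda>_. count_space UNIV)"

definition X_proc :: "nat \<Rightarrow> (nat \<Rightarrow> 's \<times> 'a \<times> 'b) \<Rightarrow> 's" where
  "X_proc n \<omega> = fst (\<omega> n)"

definition A_proc :: "nat \<Rightarrow> (nat \<Rightarrow> 's \<times> 'a \<times> 'b) \<Rightarrow> 'a" where
  "A_proc n \<omega> = fst (snd (\<omega> n))"

definition B_proc :: "nat \<Rightarrow> (nat \<Rightarrow> 's \<times> 'a \<times> 'b) \<Rightarrow> 'b" where
  "B_proc n \<omega> = snd (snd (\<omega> n))"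

lemma Ionescu_Tulcea_step_law:
  fixes G :: "('s::finite, 'a::finite, 'b::finite) rs_game"
  shows "Ionescu_Tulcea (\<lambda>n \<omega>. measure_pmf (step_law G \<pi> \<sigma> i n \<omega>)) (\<lambda>_. count_space UNIV)"
proof
  fix n :: nat
  have "PiM {0..<n} (\<lambda>_. count_space (UNIV :: ('s \<times> 'a \<times> 'b) set)) =
      count_space (PiE {0..<n} (\<lambda>_. UNIV))"
    by (intro count_space_PiM_finite) auto
  then show "(\<lambda>\<omega>. measure_pmf (step_law G \<pi> \<sigma> i n \<omega>)) \<in>
      PiM {0..<n} (\<lambda>_. count_space UNIV) \<rightarrow>\<^sub>M subprob_algebra (count_space UNIV)"
    by (auto intro!: measure_pmf_in_subprob_algebra)
qed

text \<open>The finite-dimensional distributions, which determine the law of the process.\<close>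

lemma step_law_cong:
  assumes "\<And>k. k < n \<Longrightarrow> \<omega> k = \<omega>' k"
  shows "step_law G \<pi> \<sigma> i n \<omega> = step_law G \<pi> \<sigma> i n \<omega>'"
proof -
  have eq: "map \<omega> [0..<n] = map \<omega>' [0..<n]" using assms by simp
  show ?thesis unfolding step_law_def eq using assms by (cases n) simp_all
qed

lemma
  fixes G :: "('s::finite, 'a::finite, 'b::finite) rs_game"
  shows sets_path_measure:
      "sets (path_measure G \<pi> \<sigma> i) = sets (PiM UNIV (\<lambda>_. count_space UNIV))"
    and prob_space_path_measure: "prob_space (path_measure G \<pi> \<sigma> i)"
    and path_measure_cylinder:
      "emeasure (path_measure G \<pi> \<sigma> i) {\<omega>. \<forall>k<n. \<omega> k = z k} =
         (\<Prod>k<n. ennreal (pmf (step_law G \<pi> \<sigma> i k z) (z k)))"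
proof -
  interpret IT: Ionescu_Tulcea "\<lambda>n \<omega>. measure_pmf (step_law G \<pi> \<sigma> i n \<omega>)" "\<lambda>_. count_space UNIV"
    by (rule Ionescu_Tulcea_step_law)
  have lim_eq: "path_measure G \<pi> \<sigma> i = IT.PF.lim"
    by (simp add: path_measure_def)
  show sets_eq: "sets (path_measure G \<pi> \<sigma> i) = sets (PiM UNIV (\<lambda>_. count_space UNIV))"
    by (simp add: lim_eq)
  show "prob_space (path_measure G \<pi> \<sigma> i)"
  proof
    have "emeasure IT.PF.lim (IT.PF.emb UNIV {} {\<lambda>_. undefined}) =
        emeasure (IT.CI {}) {\<lambda>_. undefined}"
      by (rule IT.lim) (auto simp: PiM_empty)
    moreover have "IT.PF.emb UNIV {} {\<lambda>_. undefined} = UNIV"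
      by (auto simp: prod_emb_def space_PiM)
    moreover have "emeasure (IT.CI {}) {\<lambda>_. undefined} = 1"
      using prob_space.emeasure_space_1[OF IT.PF.prob_space_P[of "{}"]]
      by (simp add: IT.PF.space_P space_PiM)
    moreover have "space IT.PF.lim = UNIV"
      by (simp add: space_PiM)
    ultimately show "emeasure (path_measure G \<pi> \<sigma> i) (space (path_measure G \<pi> \<sigma> i)) = 1"
      by (simp add: lim_eq)
  qed
  let ?M = "\<lambda>_::nat. count_space (UNIV :: ('s \<times> 'a \<times> 'b) set)"
  let ?r = "\<lambda>n. restrict z {0..<n}"
  have PiM_eq: "PiM {0..<n} ?M = count_space (PiE {0..<n} (\<lambda>_. UNIV))" for n
    by (intro count_space_PiM_finite) auto
  have C_eq: "emeasure (IT.C 0 n (\<lambda>_. undefined)) {?r n} =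
      (\<Prod>k<n. ennreal (pmf (step_law G \<pi> \<sigma> i k z) (z k)))" for n
  proof (induction n)
    case 0
    then show ?case by (simp add: PiM_empty restrict_def)
  next
    case (Suc n)
    have sp: "(\<lambda>_. undefined) \<in> space (PiM {0..<0} ?M)" by (simp add: space_PiM)
    have sC: "space (IT.C 0 n (\<lambda>_. undefined)) = space (PiM {0..<n} ?M)"
      using IT.space_C[OF sp, of n] by simp
    have A: "{?r (Suc n)} \<in> sets (PiM {0..<Suc n} ?M)"
      unfolding PiM_eq by auto
    have ne: "space (IT.C 0 n (\<lambda>_. undefined)) \<noteq> {}"
      by (simp add: sC space_PiM PiE_eq_empty_iff)
    have mb: "IT.eP n \<in> IT.C 0 n (\<lambda>_. undefined) \<rightarrow>\<^sub>M subprob_algebra (PiM {0..<Suc n} ?M)"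
      using IT.measurable_eP[of n] IT.sets_C[OF sp, of n]
      by (simp cong: measurable_cong_sets)
    have "emeasure (IT.C 0 (Suc n) (\<lambda>_. undefined)) {?r (Suc n)} =
        (\<integral>\<^sup>+\<omega>. emeasure (IT.eP n \<omega>) {?r (Suc n)} \<partial>IT.C 0 n (\<lambda>_. undefined))"
      using emeasure_bind[OF ne mb A] by simp
    also have "\<dots> = (\<integral>\<^sup>+\<omega>. ennreal (pmf (step_law G \<pi> \<sigma> i n z) (z n)) * indicator {?r n} \<omega>
        \<partial>IT.C 0 n (\<lambda>_. undefined))"
    proof (rule nn_integral_cong)
      fix \<omega> assume "\<omega> \<in> space (IT.C 0 n (\<lambda>_. undefined))"
      then have \<omega>: "\<omega> \<in> space (PiM {0..<n} ?M)" by (simp add: sC)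
      then have ext: "\<omega> \<in> extensional {0..<n}" by (simp add: space_PiM PiE_def)
      have vi: "(\<lambda>x. fun_upd \<omega> n x) -` {?r (Suc n)} = (if \<omega> = ?r n then {z n} else {})"
      proof -
        have "(fun_upd \<omega> n x = ?r (Suc n)) \<longleftrightarrow> x = z n \<and> \<omega> = ?r n" for x
        proof
          assume eq: "fun_upd \<omega> n x = ?r (Suc n)"
          have "x = z n" using fun_cong[OF eq, of n] by simp
          moreover have "\<omega> k = ?r n k" for k
            using fun_cong[OF eq, of k] ext by (cases "k < n") (auto simp: extensional_def)
          ultimately show "x = z n \<and> \<omega> = ?r n" by auto
        qed (auto simp: restrict_def fun_eq_iff)
        note eqv = this
        show ?thesis unfolding vimage_def singleton_iff eqv by auto
      qed
      show "emeasure (IT.eP n \<omega>) {?r (Suc n)} =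
          ennreal (pmf (step_law G \<pi> \<sigma> i n z) (z n)) * indicator {?r n} \<omega>"
      proof (cases "\<omega> = ?r n")
        case True
        have "step_law G \<pi> \<sigma> i n \<omega> = step_law G \<pi> \<sigma> i n z"
          by (rule step_law_cong) (simp add: True)
        then show ?thesis
          using IT.emeasure_eP[OF \<omega> A] True vi by (simp add: emeasure_pmf_single)
      next
        case False
        then show ?thesis using IT.emeasure_eP[OF \<omega> A] vi by simp
      qed
    qed
    also have "\<dots> = ennreal (pmf (step_law G \<pi> \<sigma> i n z) (z n)) *
        emeasure (IT.C 0 n (\<lambda>_. undefined)) {?r n}"
    proof (rule nn_integral_cmult_indicator)
      show "{?r n} \<in> sets (IT.C 0 n (\<lambda>_. undefined))"
        using IT.sets_C[OF sp, of n] by (auto simp: PiM_eq)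
    qed
    finally show ?case unfolding Suc.IH prod.lessThan_Suc by (simp only: mult.commute)
  qed
  have "emeasure IT.PF.lim (IT.PF.emb UNIV {0..<n} {?r n}) = emeasure (IT.CI {0..<n}) {?r n}"
    by (rule IT.lim) (auto simp: PiM_eq)
  also have "\<dots> = emeasure (IT.C 0 n (\<lambda>_. undefined)) (IT.PF.emb {0..<n} {0..<n} {?r n})"
    by (rule IT.emeasure_CI) (auto simp: PiM_eq)
  also have "IT.PF.emb {0..<n} {0..<n} {?r n} = {?r n}"
    by (auto simp: prod_emb_def space_PiM PiE_def extensional_restrict)
  also have "IT.PF.emb UNIV {0..<n} {?r n} = {\<omega>. \<forall>k<n. \<omega> k = z k}"
    by (auto simp: prod_emb_def space_PiM restrict_def fun_eq_iff) metis
  finally show "emeasure (path_measure G \<pi> \<sigma> i) {\<omega>. \<forall>k<n. \<omega> k = z k} =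
         (\<Prod>k<n. ennreal (pmf (step_law G \<pi> \<sigma> i k z) (z k)))"
    unfolding lim_eq C_eq .
qed

definition irreducible_under :: "('s::finite, 'a::finite, 'b::finite) rs_game \<Rightarrow>
    ('s \<Rightarrow> 'a) \<Rightarrow> ('s \<Rightarrow> 'b) \<Rightarrow> bool" where
  "irreducible_under G f g \<longleftrightarrow>
     (\<forall>i j. \<exists>n\<ge>1. 0 < \<P>(\<omega> in path_measure G (deterministic f) (deterministic g) i. X_proc n \<omega> = j))"

definition irreducibility_condition :: "('s::finite, 'a::finite, 'b::finite) rs_game \<Rightarrow> bool" where
  "irreducibility_condition G \<longleftrightarrow>
     (\<forall>f \<in> selectors (acts1 G). \<forall>g \<in> selectors (acts2 G). irreducible_under G f g)"

section \<open>The risk-sensitive average criterion\<close>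

definition J_crit :: "('s::finite, 'a::finite, 'b::finite) rs_game \<Rightarrow> 's \<Rightarrow>
    ('s, 'a, 'b, 'a) policy \<Rightarrow> ('s, 'a, 'b, 'b) policy \<Rightarrow> ereal" where
  "J_crit G i \<pi> \<sigma> = limsup (\<lambda>n. ereal (1 / (theta G * real n) *
     ln (\<integral>\<omega>. exp (theta G * (\<Sum>k<n. cost G (X_proc k \<omega>) (A_proc k \<omega>) (B_proc k \<omega>)))
           \<partial>path_measure G \<pi> \<sigma> i)))"

definition upper_value :: "('s::finite, 'a::finite, 'b::finite) rs_game \<Rightarrow> 's \<Rightarrow> ereal" where
  "upper_value G i = (INF \<pi>\<in>policies1 G. SUP \<sigma>\<in>policies2 G. J_crit G i \<pi> \<sigma>)"

definition lower_value :: "('s::finite, 'a::finite, 'b::finite) rs_game \<Rightarrow> 's \<Rightarrow> ereal" where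
  "lower_value G i = (SUP \<sigma>\<in>policies2 G. INF \<pi>\<in>policies1 G. J_crit G i \<pi> \<sigma>)"

definition is_value :: "('s::finite, 'a::finite, 'b::finite) rs_game \<Rightarrow> ('s \<Rightarrow> ereal) \<Rightarrow> bool" where
  "is_value G V \<longleftrightarrow> (\<forall>i. upper_value G i = V i \<and> lower_value G i = V i)"

text \<open>
  The notion of an \<open>\<epsilon>\<close>-saddle point refers to the value of the game; existence of the value
  is part of the definition.
\<close>

definition eps_saddle_point :: "('s::finite, 'a::finite, 'b::finite) rs_game \<Rightarrow> real \<Rightarrow>
    ('s, 'a, 'b, 'a) policy \<Rightarrow> ('s, 'a, 'b, 'b) policy \<Rightarrow> bool" where
  "eps_saddle_point G \<epsilon> \<pi>\<epsilon> \<sigma>\<epsilon> \<longleftrightarrow>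
     \<pi>\<epsilon> \<in> policies1 G \<and> \<sigma>\<epsilon> \<in> policies2 G \<and>
     (\<exists>V. is_value G V \<and>
       (\<forall>i. \<forall>\<sigma>\<in>policies2 G. J_crit G i \<pi>\<epsilon> \<sigma> \<le> V i + ereal \<epsilon>) \<and>
       (\<forall>i. \<forall>\<pi>\<in>policies1 G. V i - ereal \<epsilon> \<le> J_crit G i \<pi> \<sigma>\<epsilon>))"

section \<open>The operator and its mini-max selectors\<close>

definition Lop2 :: "('s::finite, 'a::finite, 'b::finite) rs_game \<Rightarrow> 'a pmf \<Rightarrow> 'b pmf \<Rightarrow>
    ('s \<Rightarrow> real) \<Rightarrow> 's \<Rightarrow> real" where
  "Lop2 G \<mu> \<nu> h i = (\<Sum>a\<in>acts1 G i. \<Sum>b\<in>acts2 G i. \<Sum>j\<in>UNIV.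
     exp (theta G * cost G i a b) * h j * pmf (trans_law G i a b) j * pmf \<mu> a * pmf \<nu> b)"

definition Lop :: "('s::finite, 'a::finite, 'b::finite) rs_game \<Rightarrow> ('s \<Rightarrow> real) \<Rightarrow> 's \<Rightarrow> real" where
  "Lop G h i = (INF \<mu>\<in>probs_on (acts1 G i). SUP \<nu>\<in>probs_on (acts2 G i). Lop2 G \<mu> \<nu> h i)"

definition sup_norm :: "('s::finite \<Rightarrow> real) \<Rightarrow> real" where
  "sup_norm h = (MAX i. \<bar>h i\<bar>)"

definition lambda_star :: "('s::finite, 'a::finite, 'b::finite) rs_game \<Rightarrow> real" where
  "lambda_star G = lim (\<lambda>n. root n (sup_norm ((Lop G ^^ n) (\<lambda>_. 1))))"

definition minimax_selector :: "('s::finite, 'a::finite, 'b::finite) rs_game \<Rightarrow> ('s \<Rightarrow> real) \<Rightarrow>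
    ('s \<Rightarrow> 'a pmf) \<Rightarrow> ('s \<Rightarrow> 'b pmf) \<Rightarrow> bool" where
  "minimax_selector G h \<phi> \<psi> \<longleftrightarrow>
     \<phi> \<in> stationary_kernels (acts1 G) \<and> \<psi> \<in> stationary_kernels (acts2 G) \<and>
     (\<forall>i. Lop G h i = (SUP \<nu>\<in>probs_on (acts2 G i). Lop2 G (\<phi> i) \<nu> h i) \<and>
          Lop G h i = (INF \<mu>\<in>probs_on (acts1 G i). Lop2 G \<mu> (\<psi> i) h i) \<and>
          Lop G h i = Lop2 G (\<phi> i) (\<psi> i) h i)"

end

theory Submission
  imports Defs
begin

text \<open>
  Everything rests on one verification principle. Let \<open>h > 0\<close> and \<open>K > 0\<close>. If player 1 uses a
  stationary kernel \<open>\<phi>\<close> with \<open>Lop2 G (\<phi> x) \<nu> h x \<le> K * h x\<close> for all states \<open>x\<close> and all mixed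
  actions \<open>\<nu>\<close> of player 2, then, whatever player 2 does, every step multiplies the expectation of
  \<open>exp (theta * accumulated cost) * h (current state)\<close> by at most \<open>K\<close>. As \<open>h\<close> lies between two
  positive constants, the expected exponential cost is at most a constant times \<open>K ^ n\<close>, and its
  normalized logarithm has upper limit at most \<open>ln K / theta\<close>. The reversed inequality
  gives the same guarantee from below to player 2. These are the lemmas \<open>stationary_guarantee1\<close>
  and \<open>stationary_guarantee2\<close>.

  For the value of the game, the principle is applied to the eigenfunction \<open>hstar\<close> with
  \<open>K = lambda_star G\<close>. Here both players need optimal mixed actions in the matrix game with value
  \<open>Lop G hstar x\<close>, for every state \<open>x\<close>. As the operator is defined by an infimum of suprema,
  this requires the minimax theorem, which follows from a separating hyperplane argument
  (\<open>matrix_game_alternative\<close>). So the value is \<open>ln (lambda_star G) / theta\<close>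
  (\<open>eigenfunction_value\<close>).

  For the selector of \<open>h\<close>, write \<open>e\<close> for \<open>exp (theta * \<epsilon>)\<close>. The operator is monotone and positively
  homogeneous (\<open>Lop_le_scaled\<close>), so \<open>h \<le> hstar \<le> e * h\<close> gives
  \<open>Lop G h \<le> lambda_star G * e * h\<close> and \<open>lambda_star G / e * h \<le> Lop G h\<close>. The two halves of the
  selector property turn these into the hypotheses of the principle for \<open>h\<close>, with
  \<open>K = lambda_star G * e\<close> and with \<open>K = lambda_star G / e\<close>; the logarithms of these numbers,
  divided by \<open>theta\<close>, are the value plus and minus \<open>\<epsilon>\<close>.
\<close>

section \<open>A theorem of the alternative for matrix games\<close>

lemma exists_pmf_with_weights:
  fixes w :: "'u \<Rightarrow> real"
  assumes "finite S" "\<forall>a\<in>S. 0 \<le> w a" "sum w S = 1"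
  shows "\<exists>\<mu>\<in>probs_on S. \<forall>a\<in>S. pmf \<mu> a = w a"
proof -
  define f where "f a = (if a \<in> S then w a else 0)" for a
  have "(\<integral>\<^sup>+a. ennreal (f a) \<partial>count_space UNIV) = (\<Sum>a\<in>S. ennreal (w a))"
    by (subst nn_integral_count_space'[of S]) (auto simp: f_def assms intro!: sum.cong)
  also have "\<dots> = 1"
    using assms by (subst sum_ennreal) auto
  finally have pmf: "pmf (embed_pmf f) a = f a" for a
    using assms by (intro pmf_embed_pmf) (auto simp: f_def)
  show ?thesis
    by (rule bexI[of _ "embed_pmf f"])
       (auto simp: probs_on_def pmf f_def set_pmf_iff split: if_splits)
qed

text \<open>
  Either some row mixture pays less than \<open>v\<close> in every column, which means that the convex set of
  payoff vectors of row mixtures meets the orthant \<open>D\<close>, or a hyperplane separates the two sets. In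
  the second case the normal vector is nonnegative and vanishes outside \<open>T\<close>, because \<open>D\<close> is
  unbounded below in the directions in \<open>T\<close> and in both senses in the others; normalized, it
  is the column mixture.
\<close>

lemma matrix_game_alternative:
  fixes f :: "'u \<Rightarrow> 'v::finite \<Rightarrow> real"
  assumes S: "finite S" "S \<noteq> {}"
  shows "(\<exists>\<mu>\<in>probs_on S. \<forall>b\<in>T. (\<Sum>a\<in>S. pmf \<mu> a * f a b) < v) \<or>
         (\<exists>\<nu>\<in>probs_on T. \<forall>a\<in>S. v \<le> (\<Sum>b\<in>T. pmf \<nu> b * f a b))"
proof -
  define D where "D = {x :: real^'v. \<forall>b\<in>T. x $ b < v}"
  define W :: "('u \<Rightarrow> real) set" where "W = {w. (\<forall>a\<in>S. 0 \<le> w a) \<and> sum w S = 1}"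
  define F where "F w = (\<chi> b. \<Sum>a\<in>S. w a * f a b)" for w
  have FW: "convex (F ` W)"
  proof (rule convexI)
    fix x y and s t :: real
    assume "x \<in> F ` W" "y \<in> F ` W" and st: "0 \<le> s" "0 \<le> t" "s + t = 1"
    then obtain w w' where w: "w \<in> W" "x = F w" "w' \<in> W" "y = F w'" by auto
    have "s *\<^sub>R x + t *\<^sub>R y = F (\<lambda>a. s * w a + t * w' a)"
      by (simp add: w F_def vec_eq_iff sum_distrib_left algebra_simps flip: sum.distrib)
    moreover have "(\<lambda>a. s * w a + t * w' a) \<in> W"
      using w st by (auto simp: W_def sum.distrib simp flip: sum_distrib_left)
    ultimately show "s *\<^sub>R x + t *\<^sub>R y \<in> F ` W" by blast
  qed
  have D: "convex D"
    unfolding D_def by (auto intro!: convexI convex_bound_lt)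
  obtain a0 where a0: "a0 \<in> S" using S by auto
  have point: "(\<lambda>a. if a = a0 then 1 else 0) \<in> W" if "a0 \<in> S" for a0
    using S that by (auto simp: W_def)
  have Fpoint: "F (\<lambda>a. if a = a0 then 1 else 0) = (\<chi> b. f a0 b)" if "a0 \<in> S" for a0
  proof -
    have "(\<Sum>a\<in>S. (if a = a0 then 1 else 0) * f a b) = (\<Sum>a\<in>S. if a = a0 then f a b else 0)" for b
      by (intro sum.cong) auto
    then show ?thesis using S that by (simp add: F_def vec_eq_iff)
  qed
  show ?thesis
  proof (cases "D \<inter> F ` W = {}")
    case False
    then obtain w where w: "w \<in> W" "F w \<in> D" by auto
    obtain \<mu> where "\<mu> \<in> probs_on S" "\<forall>a\<in>S. pmf \<mu> a = w a"
      using exists_pmf_with_weights[OF S(1)] w(1) by (force simp: W_def)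
    then show ?thesis
      using w(2) by (auto simp: D_def F_def intro!: disjI1 bexI[of _ \<mu>])
  next
    case True
    have "(\<chi> b. v - 1) \<in> D" by (simp add: D_def)
    then have "D \<noteq> {}" "F ` W \<noteq> {}" using point[OF a0] by auto
    then obtain c \<beta> where c: "c \<noteq> 0" "\<forall>x\<in>D. c \<bullet> x \<le> \<beta>" "\<forall>x\<in>F ` W. \<beta> \<le> c \<bullet> x"
      using separating_hyperplane_sets[OF D FW _ _ True] by auto
    \<comment> \<open>Moving a point of \<open>D\<close> along the axis \<open>b\<close>: downwards always, upwards only if \<open>b\<close> is not in \<open>T\<close>.\<close>
    have shift: "(\<Sum>b'\<in>UNIV. c $ b' * (v - 1)) + t * c $ b \<le> \<beta>" if "b \<in> T \<longrightarrow> t \<le> 0" for b t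
    proof -
      have "(\<chi> b'. v - 1 + (if b' = b then t else 0)) \<in> D"
        using that by (auto simp: D_def)
      then have "c \<bullet> (\<chi> b'. v - 1 + (if b' = b then t else 0)) \<le> \<beta>" using c by blast
      moreover have "c \<bullet> (\<chi> b'. v - 1 + (if b' = b then t else 0)) =
          (\<Sum>b'\<in>UNIV. c $ b' * (v - 1) + (if b' = b then t * c $ b' else 0))"
        unfolding inner_vec_def by (intro sum.cong) (auto simp: algebra_simps)
      ultimately show ?thesis by (simp add: sum.distrib)
    qed
    \<comment> \<open>The shifts chosen below raise the left-hand side of \<open>shift\<close> from \<open>?s\<close> to beyond \<open>\<beta>\<close>.\<close>
    let ?s = "\<Sum>b'\<in>UNIV. c $ b' * (v - 1)"
    have nonneg: "0 \<le> c $ b" for b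
    proof (rule ccontr)
      assume "\<not> 0 \<le> c $ b"
      then have "(- ((\<bar>\<beta> - ?s\<bar> + 1) / - c $ b)) * c $ b = \<bar>\<beta> - ?s\<bar> + 1"
                "- ((\<bar>\<beta> - ?s\<bar> + 1) / - c $ b) \<le> 0" by (auto simp: field_simps)
      then show False using shift[of b "- ((\<bar>\<beta> - ?s\<bar> + 1) / - c $ b)"] by linarith
    qed
    have zero: "c $ b = 0" if "b \<notin> T" for b
    proof (rule ccontr)
      assume "c $ b \<noteq> 0"
      then have "((\<bar>\<beta> - ?s\<bar> + 1) / c $ b) * c $ b = \<bar>\<beta> - ?s\<bar> + 1" by (auto simp: field_simps)
      then show False using shift[of b "(\<bar>\<beta> - ?s\<bar> + 1) / c $ b"] that by linarith
    qed
    define Z where "Z = (\<Sum>b\<in>T. c $ b)"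
    obtain b1 where b1: "c $ b1 \<noteq> 0" using c(1) by (auto simp: vec_eq_iff)
    then have "b1 \<in> T" "0 < c $ b1" using zero nonneg by (auto simp: order.strict_iff_order)
    then have Z: "0 < Z" unfolding Z_def by (intro sum_pos2[of T b1]) (auto simp: nonneg)
    have onT: "c \<bullet> x = (\<Sum>b\<in>T. c $ b * x $ b)" for x
      unfolding inner_vec_def by (auto intro!: sum.mono_neutral_right simp: zero)
    \<comment> \<open>The corner \<open>(v, \<dots>, v)\<close> is only a limit point of \<open>D\<close>, hence the \<open>e\<close>.\<close>
    have "v * Z \<le> \<beta>"
    proof (rule field_le_epsilon)
      fix e :: real assume e: "0 < e"
      have "(\<chi> b. v - e / Z) \<in> D" using e Z by (simp add: D_def)
      then have "c \<bullet> (\<chi> b. v - e / Z) \<le> \<beta>" using c by blast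
      also have "c \<bullet> (\<chi> b. v - e / Z) = Z * (v - e / Z)"
        by (simp add: onT Z_def flip: sum_distrib_right)
      also have "\<dots> = v * Z - e" using Z by (simp add: field_simps)
      finally show "v * Z \<le> \<beta> + e" by simp
    qed
    also have "\<beta> \<le> (\<Sum>b\<in>T. c $ b * f a b)" if "a \<in> S" for a
    proof -
      have "(\<chi> b. f a b) \<in> F ` W" using point[OF that] Fpoint[OF that] by (metis imageI)
      then have "\<beta> \<le> c \<bullet> (\<chi> b. f a b)" using c(3) by blast
      then show ?thesis by (simp add: onT)
    qed
    finally have cf: "v \<le> (\<Sum>b\<in>T. c $ b / Z * f a b)" if "a \<in> S" for a
      using Z that by (simp add: pos_le_divide_eq flip: sum_divide_distrib)
    obtain \<nu> where "\<nu> \<in> probs_on T" "\<forall>b\<in>T. pmf \<nu> b = c $ b / Z"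
      using exists_pmf_with_weights[of T "\<lambda>b. c $ b / Z"] nonneg Z
      by (auto simp: Z_def simp flip: sum_divide_distrib)
    then show ?thesis using cf by (intro disjI2 bexI[of _ \<nu>]) auto
  qed
qed

section \<open>The operator as a family of matrix games\<close>

text \<open>
  The entries of the matrix game which the operator solves in state \<open>i\<close>.
\<close>

definition stage_payoff :: "('s::finite, 'a::finite, 'b::finite) rs_game \<Rightarrow> ('s \<Rightarrow> real) \<Rightarrow>
    's \<Rightarrow> 'a \<Rightarrow> 'b \<Rightarrow> real" where
  "stage_payoff G h i a b =
     exp (theta G * cost G i a b) * measure_pmf.expectation (trans_law G i a b) h"

lemma expectation_finite_type:
  fixes f :: "'u::finite \<Rightarrow> real"
  shows "measure_pmf.expectation p f = (\<Sum>x\<in>UNIV. pmf p x * f x)"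
  by (subst integral_measure_pmf_real[of UNIV]) (auto simp: mult.commute)

lemma Lop2_eq_rows:
  "Lop2 G \<mu> \<nu> h i = (\<Sum>a\<in>acts1 G i. pmf \<mu> a * (\<Sum>b\<in>acts2 G i. pmf \<nu> b * stage_payoff G h i a b))"
  unfolding Lop2_def stage_payoff_def expectation_finite_type sum_distrib_left
  by (intro sum.cong refl) (simp add: algebra_simps)

lemma Lop2_eq_columns:
  "Lop2 G \<mu> \<nu> h i = (\<Sum>b\<in>acts2 G i. pmf \<nu> b * (\<Sum>a\<in>acts1 G i. pmf \<mu> a * stage_payoff G h i a b))"
  unfolding Lop2_eq_rows sum_distrib_left
  by (subst sum.swap) (intro sum.cong refl, simp add: algebra_simps)

lemma probs_on_average_le:
  fixes f :: "'u::finite \<Rightarrow> real"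
  assumes "\<mu> \<in> probs_on S" "\<And>a. a \<in> S \<Longrightarrow> f a \<le> c"
  shows "(\<Sum>a\<in>S. pmf \<mu> a * f a) \<le> c"
proof -
  have "(\<Sum>a\<in>S. pmf \<mu> a * f a) \<le> (\<Sum>a\<in>S. pmf \<mu> a * c)"
    using assms by (intro sum_mono mult_left_mono) auto
  also have "\<dots> = c"
    using assms by (simp add: probs_on_def sum_pmf_eq_1 flip: sum_distrib_right)
  finally show ?thesis .
qed

lemma probs_on_average_ge:
  fixes f :: "'u::finite \<Rightarrow> real"
  assumes "\<mu> \<in> probs_on S" "\<And>a. a \<in> S \<Longrightarrow> c \<le> f a"
  shows "c \<le> (\<Sum>a\<in>S. pmf \<mu> a * f a)"
  using probs_on_average_le[of \<mu> S "\<lambda>a. - f a" "- c"] assms by (simp add: sum_negf)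

text \<open>
  The infima and suprema in the operator are taken in the reals, where order lemmas
  about them require bounds.
\<close>

lemma Lop2_bounded:
  "\<exists>R. \<forall>\<mu>\<in>probs_on (acts1 G i). \<forall>\<nu>\<in>probs_on (acts2 G i). Lop2 G \<mu> \<nu> h i \<le> R \<and> - R \<le> Lop2 G \<mu> \<nu> h i"
proof -
  define R where "R = (\<Sum>a\<in>UNIV. \<Sum>b\<in>UNIV. \<bar>stage_payoff G h i a b\<bar>)"
  have "\<bar>stage_payoff G h i a b\<bar> \<le> R" for a b
  proof -
    have "\<bar>stage_payoff G h i a b\<bar> \<le> (\<Sum>b\<in>UNIV. \<bar>stage_payoff G h i a b\<bar>)"
      by (rule member_le_sum) auto
    also have "\<dots> \<le> R"
      unfolding R_def by (rule member_le_sum) (auto intro: sum_nonneg)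
    finally show ?thesis .
  qed
  then have R: "stage_payoff G h i a b \<le> R" "- R \<le> stage_payoff G h i a b" for a b
    by (simp_all add: abs_le_iff minus_le_iff)
  have "Lop2 G \<mu> \<nu> h i \<le> R \<and> - R \<le> Lop2 G \<mu> \<nu> h i"
    if "\<mu> \<in> probs_on (acts1 G i)" "\<nu> \<in> probs_on (acts2 G i)" for \<mu> \<nu>
    unfolding Lop2_eq_rows
    by (intro conjI probs_on_average_le[OF that(1)] probs_on_average_ge[OF that(1)]
        probs_on_average_le[OF that(2)] probs_on_average_ge[OF that(2)] R)
  then show ?thesis by blast
qed

lemma Lop2_le_SUP:
  assumes "\<mu> \<in> probs_on (acts1 G i)" "\<nu> \<in> probs_on (acts2 G i)"
  shows "Lop2 G \<mu> \<nu> h i \<le> (SUP \<nu>\<in>probs_on (acts2 G i). Lop2 G \<mu> \<nu> h i)"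
proof -
  obtain R where "\<forall>\<nu>\<in>probs_on (acts2 G i). Lop2 G \<mu> \<nu> h i \<le> R"
    using Lop2_bounded assms(1) by metis
  then show ?thesis
    by (intro cSUP_upper[OF assms(2)] bdd_aboveI2) blast
qed

lemma INF_le_Lop2:
  assumes "\<mu> \<in> probs_on (acts1 G i)" "\<nu> \<in> probs_on (acts2 G i)"
  shows "(INF \<mu>\<in>probs_on (acts1 G i). Lop2 G \<mu> \<nu> h i) \<le> Lop2 G \<mu> \<nu> h i"
proof -
  obtain R where "\<forall>\<mu>\<in>probs_on (acts1 G i). R \<le> Lop2 G \<mu> \<nu> h i"
    using Lop2_bounded assms(2) by metis
  then show ?thesis
    by (intro cINF_lower[OF _ assms(1)] bdd_belowI2) blast
qed

lemma return_pmf_in_probs_on: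
  assumes "a \<in> S"
  shows "return_pmf a \<in> probs_on S"
  using assms by (simp add: probs_on_def)

lemma
  assumes "valid_game G"
  shows probs_on_acts1_nonempty: "probs_on (acts1 G i) \<noteq> {}"
    and probs_on_acts2_nonempty: "probs_on (acts2 G i) \<noteq> {}"
  using assms return_pmf_in_probs_on by (metis valid_game_def ex_in_conv)+

lemma Lop_le_SUP:
  assumes "valid_game G" "\<mu> \<in> probs_on (acts1 G i)"
  shows "Lop G h i \<le> (SUP \<nu>\<in>probs_on (acts2 G i). Lop2 G \<mu> \<nu> h i)"
proof -
  obtain R where R: "\<forall>\<mu>\<in>probs_on (acts1 G i). \<forall>\<nu>\<in>probs_on (acts2 G i). R \<le> Lop2 G \<mu> \<nu> h i"
    using Lop2_bounded by metis
  obtain \<nu> where \<nu>: "\<nu> \<in> probs_on (acts2 G i)"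
    using probs_on_acts2_nonempty[OF assms(1)] by blast
  have "R \<le> (SUP \<nu>\<in>probs_on (acts2 G i). Lop2 G \<mu> \<nu> h i)" if "\<mu> \<in> probs_on (acts1 G i)" for \<mu>
    using R \<nu> that Lop2_le_SUP[OF that \<nu>, of h] by (meson order_trans)
  then show ?thesis
    unfolding Lop_def by (intro cINF_lower[OF bdd_belowI2 assms(2)])
qed

lemma le_LopI:
  assumes "valid_game G"
    and "\<And>\<mu>. \<mu> \<in> probs_on (acts1 G i) \<Longrightarrow> \<exists>\<nu>\<in>probs_on (acts2 G i). c \<le> Lop2 G \<mu> \<nu> h i"
  shows "c \<le> Lop G h i"
  unfolding Lop_def
proof (rule cINF_greatest)
  show "probs_on (acts1 G i) \<noteq> {}"
    using probs_on_acts1_nonempty[OF assms(1)] .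
  show "c \<le> (SUP \<nu>\<in>probs_on (acts2 G i). Lop2 G \<mu> \<nu> h i)" if "\<mu> \<in> probs_on (acts1 G i)" for \<mu>
    using assms(2)[OF that] Lop2_le_SUP[OF that] order_trans by blast
qed

lemma Lop_leI:
  assumes "valid_game G" "\<mu> \<in> probs_on (acts1 G i)"
    and "\<And>\<nu>. \<nu> \<in> probs_on (acts2 G i) \<Longrightarrow> Lop2 G \<mu> \<nu> h i \<le> c"
  shows "Lop G h i \<le> c"
proof -
  have "probs_on (acts2 G i) \<noteq> {}"
    using probs_on_acts2_nonempty[OF assms(1)] .
  then have "(SUP \<nu>\<in>probs_on (acts2 G i). Lop2 G \<mu> \<nu> h i) \<le> c"
    using assms by (intro cSUP_least) auto
  then show ?thesis using Lop_le_SUP[OF assms(1,2), of h] by linarith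
qed

lemma stage_payoff_le:
  assumes "\<And>j. h j \<le> c * g j"
  shows "stage_payoff G h i a b \<le> c * stage_payoff G g i a b"
proof -
  have "measure_pmf.expectation (trans_law G i a b) h
      \<le> (\<Sum>j\<in>UNIV. pmf (trans_law G i a b) j * (c * g j))"
    unfolding expectation_finite_type using assms by (intro sum_mono mult_left_mono) auto
  also have "\<dots> = c * measure_pmf.expectation (trans_law G i a b) g"
    by (simp add: expectation_finite_type sum_distrib_left algebra_simps)
  finally show ?thesis
    by (simp add: stage_payoff_def mult.left_commute)
qed

text \<open>
  Monotonicity (\<open>c = 1\<close>) and positive homogeneity of the operator in a single inequality.
\<close>

lemma Lop_le_scaled:
  assumes "valid_game G" "0 < c" "\<And>j. h j \<le> c * g j"
  shows "Lop G h i \<le> c * Lop G g i"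
proof -
  have "Lop G h i / c \<le> Lop G g i"
    unfolding Lop_def[of G g]
  proof (rule cINF_greatest)
    show "probs_on (acts1 G i) \<noteq> {}"
      using probs_on_acts1_nonempty[OF assms(1)] .
    fix \<mu> assume \<mu>: "\<mu> \<in> probs_on (acts1 G i)"
    let ?s = "SUP \<nu>\<in>probs_on (acts2 G i). Lop2 G \<mu> \<nu> g i"
    have "Lop G h i \<le> c * ?s"
    proof (rule Lop_leI[OF assms(1) \<mu>])
      fix \<nu> assume \<nu>: "\<nu> \<in> probs_on (acts2 G i)"
      have "Lop2 G \<mu> \<nu> h i \<le> (\<Sum>a\<in>acts1 G i. pmf \<mu> a * (\<Sum>b\<in>acts2 G i. pmf \<nu> b * (c * stage_payoff G g i a b)))"
        unfolding Lop2_eq_rows by (intro sum_mono mult_left_mono stage_payoff_le assms) auto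
      also have "\<dots> = c * Lop2 G \<mu> \<nu> g i"
        by (simp add: Lop2_eq_rows sum_distrib_left algebra_simps)
      also have "\<dots> \<le> c * ?s"
        using Lop2_le_SUP[OF \<mu> \<nu>] assms(2) by (intro mult_left_mono) auto
      finally show "Lop2 G \<mu> \<nu> h i \<le> c * ?s" .
    qed
    then show "Lop G h i / c \<le> ?s"
      using assms(2) by (simp add: field_simps)
  qed
  then show ?thesis using assms(2) by (simp add: field_simps)
qed

text \<open>
  Since costs are nonnegative, every entry of the matrix game is at least the minimum of \<open>h\<close>.
\<close>

lemma Lop_pos:
  assumes G: "valid_game G" and h: "\<And>j. 0 < h j"
  shows "0 < Lop G h i"
proof -
  define m where "m = Min (range h)"
  have m: "0 < m" "m \<le> h j" for j
    using h by (auto simp: m_def)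
  have pay: "m \<le> stage_payoff G h i a b" if "a \<in> acts1 G i" "b \<in> acts2 G i" for a b
  proof -
    have "m \<le> (\<Sum>j\<in>UNIV. pmf (trans_law G i a b) j * h j)"
      using m by (intro probs_on_average_ge) (auto simp: probs_on_def)
    moreover have "1 \<le> exp (theta G * cost G i a b)"
      using G that by (auto simp: valid_game_def adm_def)
    ultimately show ?thesis
      using m(1) mult_mono[of 1 "exp (theta G * cost G i a b)" m "\<Sum>j\<in>UNIV. pmf (trans_law G i a b) j * h j"]
      by (simp add: stage_payoff_def expectation_finite_type)
  qed
  have "m \<le> Lop G h i"
  proof (rule le_LopI[OF G])
    fix \<mu> assume \<mu>: "\<mu> \<in> probs_on (acts1 G i)"
    obtain \<nu> where \<nu>: "\<nu> \<in> probs_on (acts2 G i)"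
      using probs_on_acts2_nonempty[OF G] by blast
    show "\<exists>\<nu>\<in>probs_on (acts2 G i). m \<le> Lop2 G \<mu> \<nu> h i"
      using \<mu> \<nu> pay unfolding Lop2_eq_rows
      by (intro bexI[of _ \<nu>] probs_on_average_ge) auto
  qed
  then show ?thesis using m(1) by simp
qed

text \<open>
  The alternative is applied to the transposed game with payoffs negated, at the level
  \<open>Lop G h i\<close>. Its first case, a mixture of player 2 which earns strictly more than
  \<open>Lop G h i\<close> against each action of player 1, is absurd: the minimum of these earnings
  over the finitely many actions would be a lower bound for the operator.
\<close>

lemma exists_optimal_mixture1:
  assumes G: "valid_game G"
  shows "\<exists>\<mu>\<in>probs_on (acts1 G i). \<forall>\<nu>\<in>probs_on (acts2 G i). Lop2 G \<mu> \<nu> h i \<le> Lop G h i"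
proof -
  have ne: "acts1 G i \<noteq> {}" "acts2 G i \<noteq> {}" using G by (auto simp: valid_game_def)
  consider \<nu> where "\<nu> \<in> probs_on (acts2 G i)"
      "\<forall>a\<in>acts1 G i. Lop G h i < (\<Sum>b\<in>acts2 G i. pmf \<nu> b * stage_payoff G h i a b)"
    | \<mu> where "\<mu> \<in> probs_on (acts1 G i)"
      "\<forall>b\<in>acts2 G i. (\<Sum>a\<in>acts1 G i. pmf \<mu> a * stage_payoff G h i a b) \<le> Lop G h i"
    using matrix_game_alternative[of "acts2 G i" "acts1 G i" "\<lambda>b a. - stage_payoff G h i a b" "- Lop G h i"] ne
    by (auto simp: sum_negf)
  then show ?thesis
  proof cases
    case 1
    define v where "v = (MIN a\<in>acts1 G i. \<Sum>b\<in>acts2 G i. pmf \<nu> b * stage_payoff G h i a b)"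
    have "v \<le> (\<Sum>b\<in>acts2 G i. pmf \<nu> b * stage_payoff G h i a b)" if "a \<in> acts1 G i" for a
      unfolding v_def using that by (intro Min_le) auto
    then have "v \<le> Lop2 G \<mu> \<nu> h i" if "\<mu> \<in> probs_on (acts1 G i)" for \<mu>
      unfolding Lop2_eq_rows by (rule probs_on_average_ge[OF that])
    then have "v \<le> Lop G h i"
      using 1(1) by (intro le_LopI[OF G]) blast
    moreover have "Lop G h i < v"
      using 1(2) ne by (auto simp: v_def)
    ultimately show ?thesis by simp
  next
    case 2
    have "Lop2 G \<mu> \<nu> h i \<le> Lop G h i" if "\<nu> \<in> probs_on (acts2 G i)" for \<nu>
      unfolding Lop2_eq_columns using 2(2) by (intro probs_on_average_le[OF that]) blast
    then show ?thesis using 2(1) by blast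
  qed
qed

text \<open>
  Here the alternative is applied to the game itself, and the absurd case is a mixture of player 1
  which keeps the payoff strictly below \<open>Lop G h i\<close>.
\<close>

lemma exists_optimal_mixture2:
  assumes G: "valid_game G"
  shows "\<exists>\<nu>\<in>probs_on (acts2 G i). \<forall>\<mu>\<in>probs_on (acts1 G i). Lop G h i \<le> Lop2 G \<mu> \<nu> h i"
proof -
  have ne: "acts1 G i \<noteq> {}" "acts2 G i \<noteq> {}" using G by (auto simp: valid_game_def)
  consider \<mu> where "\<mu> \<in> probs_on (acts1 G i)"
      "\<forall>b\<in>acts2 G i. (\<Sum>a\<in>acts1 G i. pmf \<mu> a * stage_payoff G h i a b) < Lop G h i"
    | \<nu> where "\<nu> \<in> probs_on (acts2 G i)"
      "\<forall>a\<in>acts1 G i. Lop G h i \<le> (\<Sum>b\<in>acts2 G i. pmf \<nu> b * stage_payoff G h i a b)"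
    using matrix_game_alternative[of "acts1 G i" "acts2 G i" "stage_payoff G h i" "Lop G h i"] ne
    by auto
  then show ?thesis
  proof cases
    case 1
    define v where "v = (MAX b\<in>acts2 G i. \<Sum>a\<in>acts1 G i. pmf \<mu> a * stage_payoff G h i a b)"
    have "(\<Sum>a\<in>acts1 G i. pmf \<mu> a * stage_payoff G h i a b) \<le> v" if "b \<in> acts2 G i" for b
      unfolding v_def using that by (intro Max_ge) auto
    then have "Lop2 G \<mu> \<nu> h i \<le> v" if "\<nu> \<in> probs_on (acts2 G i)" for \<nu>
      unfolding Lop2_eq_columns by (rule probs_on_average_le[OF that])
    then have "Lop G h i \<le> v"
      by (intro Lop_leI[OF G 1(1)])
    moreover have "v < Lop G h i"
      using 1(2) ne by (auto simp: v_def)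
    ultimately show ?thesis by simp
  next
    case 2
    have "Lop G h i \<le> Lop2 G \<mu> \<nu> h i" if "\<mu> \<in> probs_on (acts1 G i)" for \<mu>
      unfolding Lop2_eq_rows using 2(2) by (intro probs_on_average_ge[OF that]) blast
    then show ?thesis using 2(1) by blast
  qed
qed

section \<open>The law of finite histories\<close>

text \<open>
  Conditional laws as functions of the list of past triples. Expectations of functions of finitely
  many steps thereby become expectations over a finitely supported law on lists, where no
  measurability or integrability has to be checked.
\<close>

definition next_state_law :: "('s, 'a, 'b) rs_game \<Rightarrow> 's \<Rightarrow> ('s \<times> 'a \<times> 'b) list \<Rightarrow> 's pmf" where
  "next_state_law G i xs =
     (if xs = [] then return_pmf i else (case last xs of (x, a, b) \<Rightarrow> trans_law G x a b))"

definition next_triple_law :: "('s, 'a, 'b) rs_game \<Rightarrow> ('s, 'a, 'b, 'a) policy \<Rightarrow> ('s, 'a, 'b, 'b) policy \<Rightarrow>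
    's \<Rightarrow> ('s \<times> 'a \<times> 'b) list \<Rightarrow> ('s \<times> 'a \<times> 'b) pmf" where
  "next_triple_law G \<pi> \<sigma> i xs =
     bind_pmf (next_state_law G i xs)
       (\<lambda>x. map_pmf (Pair x) (pair_pmf (\<pi> (length xs) xs x) (\<sigma> (length xs) xs x)))"

primrec history_law :: "('s, 'a, 'b) rs_game \<Rightarrow> ('s, 'a, 'b, 'a) policy \<Rightarrow> ('s, 'a, 'b, 'b) policy \<Rightarrow>
    's \<Rightarrow> nat \<Rightarrow> ('s \<times> 'a \<times> 'b) list pmf" where
  "history_law G \<pi> \<sigma> i 0 = return_pmf []"
| "history_law G \<pi> \<sigma> i (Suc n) =
     bind_pmf (history_law G \<pi> \<sigma> i n) (\<lambda>xs. map_pmf (\<lambda>t. xs @ [t]) (next_triple_law G \<pi> \<sigma> i xs))"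

text \<open>
  The list \<open>ys\<close> stands for the future, on which the conditional law does not depend.
\<close>

lemma step_law_eq_next_triple_law:
  "step_law G \<pi> \<sigma> i (length xs) (\<lambda>k. (xs @ ys) ! k) = next_triple_law G \<pi> \<sigma> i xs"
proof -
  have "map (\<lambda>k. (xs @ ys) ! k) [0..<length xs] = xs"
    by (rule nth_equalityI) (auto simp: nth_append)
  moreover have "(case length xs of 0 \<Rightarrow> return_pmf i | Suc m \<Rightarrow>
      (case (xs @ ys) ! m of (x, a, b) \<Rightarrow> trans_law G x a b)) = next_state_law G i xs"
    by (cases xs rule: rev_cases) (auto simp: next_state_law_def nth_append)
  ultimately show ?thesis
    unfolding step_law_def next_triple_law_def by simp
qed

lemma length_history: "xs \<in> set_pmf (history_law G \<pi> \<sigma> i n) \<Longrightarrow> length xs = n"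
  by (induction n arbitrary: xs) auto

lemma pmf_history_law_snoc:
  "pmf (history_law G \<pi> \<sigma> i (Suc n)) (xs @ [t]) =
     pmf (history_law G \<pi> \<sigma> i n) xs * pmf (next_triple_law G \<pi> \<sigma> i xs) t"
proof -
  have "pmf (map_pmf (\<lambda>t. ys @ [t]) (next_triple_law G \<pi> \<sigma> i ys)) (xs @ [t]) =
      indicator {xs} ys * pmf (next_triple_law G \<pi> \<sigma> i xs) t" for ys
  proof (cases "ys = xs")
    case True
    have "pmf (map_pmf (\<lambda>t. xs @ [t]) (next_triple_law G \<pi> \<sigma> i xs)) (xs @ [t]) =
        pmf (next_triple_law G \<pi> \<sigma> i xs) t"
      by (rule pmf_map_inj') (auto intro: injI)
    then show ?thesis using True by simp
  next
    case False
    then show ?thesis by (auto simp: pmf_eq_0_set_pmf)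
  qed
  then show ?thesis
    by (simp add: pmf_bind measure_pmf_single)
qed

lemma pmf_history_law:
  "length xs = n \<Longrightarrow>
     pmf (history_law G \<pi> \<sigma> i n) xs = (\<Prod>k<n. pmf (step_law G \<pi> \<sigma> i k (\<lambda>k. xs ! k)) (xs ! k))"
proof (induction xs arbitrary: n rule: rev_induct)
  case Nil
  then show ?case by simp
next
  case (snoc t xs)
  let ?z = "\<lambda>k. (xs @ [t]) ! k"
  have n: "n = Suc (length xs)" using snoc.prems by simp
  have "step_law G \<pi> \<sigma> i k ?z = step_law G \<pi> \<sigma> i k (\<lambda>k. xs ! k)" if "k < length xs" for k
    using that by (intro step_law_cong) (simp add: nth_append)
  then have "(\<Prod>k<length xs. pmf (step_law G \<pi> \<sigma> i k ?z) (?z k)) = pmf (history_law G \<pi> \<sigma> i (length xs)) xs"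
    by (simp add: snoc.IH nth_append)
  moreover have "step_law G \<pi> \<sigma> i (length xs) ?z = next_triple_law G \<pi> \<sigma> i xs"
    by (rule step_law_eq_next_triple_law)
  ultimately show ?case
    unfolding n pmf_history_law_snoc by simp
qed

lemma finite_lists_of_length: "finite {xs :: 'u::finite list. length xs = n}"
  using finite_lists_length_eq[of "UNIV :: 'u set" n] by simp

text \<open>
  The passage from the measure on infinite paths to the laws of finite histories: a function of the
  first \<open>n\<close> triples is a finite combination of indicators of cylinders, whose probabilities are
  known.
\<close>

lemma expectation_path_measure_prefix:
  fixes F :: "('s::finite \<times> 'a::finite \<times> 'b::finite) list \<Rightarrow> real"
  shows "(\<integral>\<omega>. F (map \<omega> [0..<n]) \<partial>path_measure G \<pi> \<sigma> i) =
    measure_pmf.expectation (history_law G \<pi> \<sigma> i n) F"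
proof -
  interpret prob_space "path_measure G \<pi> \<sigma> i" by (rule prob_space_path_measure)
  let ?N = "{xs :: ('s \<times> 'a \<times> 'b) list. length xs = n}"
  define cyl where "cyl xs = {\<omega> :: nat \<Rightarrow> 's \<times> 'a \<times> 'b. \<forall>k<n. \<omega> k = xs ! k}" for xs
  have sets: "cyl xs \<in> sets (path_measure G \<pi> \<sigma> i)" for xs
  proof -
    have "cyl xs = (\<Inter>k\<in>{..<n}. {\<omega> \<in> space (PiM UNIV (\<lambda>_. count_space UNIV)). \<omega> k \<in> {xs ! k}}) \<inter> space (PiM UNIV (\<lambda>_. count_space UNIV))"
      by (auto simp: cyl_def space_PiM)
    also have "\<dots> \<in> sets (PiM UNIV (\<lambda>_::nat. count_space UNIV))"
      by measurable
    finally show ?thesis by (simp add: sets_path_measure)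
  qed
  have prob: "measure (path_measure G \<pi> \<sigma> i) (cyl xs) = pmf (history_law G \<pi> \<sigma> i n) xs" if "xs \<in> ?N" for xs
    using path_measure_cylinder[of G \<pi> \<sigma> i n "\<lambda>k. xs ! k"] that
    by (simp add: cyl_def measure_def pmf_history_law prod_ennreal prod_nonneg)
  have mem: "\<omega> \<in> cyl xs \<longleftrightarrow> map \<omega> [0..<n] = xs" if "xs \<in> ?N" for \<omega> xs
    using that by (auto simp: cyl_def list_eq_iff_nth_eq)
  have "F (map \<omega> [0..<n]) = (\<Sum>xs\<in>?N. F xs * indicator (cyl xs) \<omega>)" for \<omega>
  proof -
    have "(\<Sum>xs\<in>?N. F xs * indicator (cyl xs) \<omega>) =
        (\<Sum>xs\<in>?N. if xs = map \<omega> [0..<n] then F xs else 0)"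
      by (intro sum.cong refl) (auto simp: mem indicator_def)
    then show ?thesis by (simp add: finite_lists_of_length)
  qed
  then have "(\<integral>\<omega>. F (map \<omega> [0..<n]) \<partial>path_measure G \<pi> \<sigma> i) =
      (\<integral>\<omega>. (\<Sum>xs\<in>?N. F xs * indicator (cyl xs) \<omega>) \<partial>path_measure G \<pi> \<sigma> i)" by simp
  also have "\<dots> = (\<Sum>xs\<in>?N. F xs * measure (path_measure G \<pi> \<sigma> i) (cyl xs))"
    using sets by (subst Bochner_Integration.integral_sum) (auto simp: emeasure_eq_measure)
  also have "\<dots> = (\<Sum>xs\<in>?N. F xs * pmf (history_law G \<pi> \<sigma> i n) xs)"
    by (intro sum.cong refl) (simp add: prob)
  also have "\<dots> = measure_pmf.expectation (history_law G \<pi> \<sigma> i n) F"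
    by (rule integral_measure_pmf_real[symmetric]) (auto simp: finite_lists_of_length length_history)
  finally show ?thesis .
qed


lemma expectation_bind_finite:
  fixes h :: "'v \<Rightarrow> real"
  assumes "finite (set_pmf p)" "\<And>x. x \<in> set_pmf p \<Longrightarrow> finite (set_pmf (f x))"
  shows "measure_pmf.expectation (bind_pmf p f) h =
    measure_pmf.expectation p (\<lambda>x. measure_pmf.expectation (f x) h)"
  by (subst pmf_expectation_bind[OF assms(1)])
     (auto simp: assms integral_measure_pmf[OF assms(1)])

lemma finite_history_law: 
  fixes G :: "('s::finite, 'a::finite, 'b::finite) rs_game"
  shows "finite (set_pmf (history_law G \<pi> \<sigma> i n))"
  by (rule finite_subset[OF _ finite_lists_of_length[of n]]) (auto dest: length_history)

text \<open>
  Policies are constrained only along admissible histories, so almost sure admissibility is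
  proved together with the evolution of the process, by induction on time.
\<close>

lemma history_admissible:
  assumes "\<pi> \<in> policies1 G" "\<sigma> \<in> policies2 G"
    and "xs \<in> set_pmf (history_law G \<pi> \<sigma> i n)"
  shows "set xs \<subseteq> adm G"
  using assms(3)
proof (induction n arbitrary: xs)
  case 0
  then show ?case by simp
next
  case (Suc n)
  then obtain ys x a b where ys: "ys \<in> set_pmf (history_law G \<pi> \<sigma> i n)" "xs = ys @ [(x, a, b)]"
    and ab: "a \<in> set_pmf (\<pi> (length ys) ys x)" "b \<in> set_pmf (\<sigma> (length ys) ys x)"
    by (auto simp: next_triple_law_def)
  have "(ys, x) \<in> histories G (length ys)"
    using Suc.IH[OF ys(1)] by (simp add: histories_def)
  then have "(x, a, b) \<in> adm G"
    using assms(1,2) ab by (fastforce simp: policies_def adm_def)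
  then show ?case using Suc.IH[OF ys(1)] ys(2) by simp
qed

section \<open>Exponential growth of the expected cost\<close>

definition path_cost :: "('s, 'a, 'b) rs_game \<Rightarrow> ('s \<times> 'a \<times> 'b) list \<Rightarrow> real" where
  "path_cost G xs = (\<Sum>(x, a, b)\<leftarrow>xs. cost G x a b)"

definition exp_cost :: "('s::finite, 'a::finite, 'b::finite) rs_game \<Rightarrow>
    ('s, 'a, 'b, 'a) policy \<Rightarrow> ('s, 'a, 'b, 'b) policy \<Rightarrow> 's \<Rightarrow> nat \<Rightarrow> real" where
  "exp_cost G \<pi> \<sigma> i n =
     measure_pmf.expectation (history_law G \<pi> \<sigma> i n) (\<lambda>xs. exp (theta G * path_cost G xs))"

text \<open>
  The expectation of \<open>exp (theta * (cost up to time n)) * h (X n)\<close>. The factor for the state at time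
  \<open>n\<close> enters through its conditional expectation given the first \<open>n\<close> triples, as a history
  contains a state only together with the actions taken in it.
\<close>

definition exp_cost_terminal :: "('s::finite, 'a::finite, 'b::finite) rs_game \<Rightarrow>
    ('s, 'a, 'b, 'a) policy \<Rightarrow> ('s, 'a, 'b, 'b) policy \<Rightarrow> ('s \<Rightarrow> real) \<Rightarrow> 's \<Rightarrow> nat \<Rightarrow> real" where
  "exp_cost_terminal G \<pi> \<sigma> h i n =
     measure_pmf.expectation (history_law G \<pi> \<sigma> i n)
       (\<lambda>xs. exp (theta G * path_cost G xs) * measure_pmf.expectation (next_state_law G i xs) h)"

lemma J_crit_eq:
  "J_crit G i \<pi> \<sigma> = limsup (\<lambda>n. ereal (1 / (theta G * real n) * ln (exp_cost G \<pi> \<sigma> i n)))"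
proof -
  have "(\<Sum>k<n. cost G (X_proc k \<omega>) (A_proc k \<omega>) (B_proc k \<omega>)) = path_cost G (map \<omega> [0..<n])" for n \<omega>
    by (simp add: path_cost_def X_proc_def A_proc_def B_proc_def case_prod_beta comp_def
        interv_sum_list_conv_sum_set_nat atLeast0LessThan)
  then show ?thesis
    unfolding J_crit_def exp_cost_def
    by (simp add: expectation_path_measure_prefix[where F="\<lambda>xs. exp (theta G * path_cost G xs)"])
qed

text \<open>
  The actions are independent given the state, so averaging the payoff over the two mixed actions
  gives the bilinear operator \<open>Lop2\<close>.
\<close>

lemma expectation_next_triple:
  fixes G :: "('s::finite, 'a::finite, 'b::finite) rs_game"
  assumes \<pi>: "\<pi> \<in> policies1 G" and \<sigma>: "\<sigma> \<in> policies2 G" and xs: "set xs \<subseteq> adm G"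
  shows "measure_pmf.expectation (next_triple_law G \<pi> \<sigma> i xs) (\<lambda>(x, a, b). stage_payoff G h x a b) =
    measure_pmf.expectation (next_state_law G i xs)
      (\<lambda>x. Lop2 G (\<pi> (length xs) xs x) (\<sigma> (length xs) xs x) h x)"
proof -
  have "measure_pmf.expectation (pair_pmf (\<pi> (length xs) xs x) (\<sigma> (length xs) xs x))
      (\<lambda>(a, b). stage_payoff G h x a b) = Lop2 G (\<pi> (length xs) xs x) (\<sigma> (length xs) xs x) h x" for x
  proof -
    let ?\<mu> = "\<pi> (length xs) xs x" and ?\<nu> = "\<sigma> (length xs) xs x"
    have mem: "(xs, x) \<in> histories G (length xs)"
      using xs by (simp add: histories_def)
    have supp: "pmf ?\<mu> a = 0" if "a \<notin> acts1 G x" for a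
      using \<pi> mem that by (fastforce simp: policies_def set_pmf_iff)
    have supp': "pmf ?\<nu> b = 0" if "b \<notin> acts2 G x" for b
      using \<sigma> mem that by (fastforce simp: policies_def set_pmf_iff)
    have "measure_pmf.expectation (pair_pmf ?\<mu> ?\<nu>) (\<lambda>(a, b). stage_payoff G h x a b) =
        (\<Sum>a\<in>UNIV. pmf ?\<mu> a * (\<Sum>b\<in>UNIV. pmf ?\<nu> b * stage_payoff G h x a b))"
      unfolding pair_pmf_def by (simp add: expectation_bind_finite expectation_finite_type[of ?\<mu>] expectation_finite_type[of ?\<nu>])
    also have "\<dots> = (\<Sum>a\<in>acts1 G x. pmf ?\<mu> a * (\<Sum>b\<in>UNIV. pmf ?\<nu> b * stage_payoff G h x a b))"
      by (rule sum.mono_neutral_right) (auto simp: supp)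
    also have "\<dots> = Lop2 G ?\<mu> ?\<nu> h x"
      unfolding Lop2_eq_rows
      by (intro sum.cong refl arg_cong2[where f="(*)"] sum.mono_neutral_right) (auto simp: supp')
    finally show ?thesis .
  qed
  then show ?thesis
    unfolding next_triple_law_def by (subst expectation_bind_finite) auto
qed

lemma exp_cost_terminal_0: "exp_cost_terminal G \<pi> \<sigma> h i 0 = h i"
  by (simp add: exp_cost_terminal_def path_cost_def next_state_law_def)

text \<open>
  One more step of the process replaces the terminal function \<open>h\<close> by its image under \<open>Lop2\<close> at the
  mixed actions which the policies prescribe. The growth estimates below iterate this identity.
\<close>

lemma exp_cost_terminal_Suc:
  assumes "\<pi> \<in> policies1 G" "\<sigma> \<in> policies2 G"
  shows "exp_cost_terminal G \<pi> \<sigma> h i (Suc n) =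
    measure_pmf.expectation (history_law G \<pi> \<sigma> i n)
      (\<lambda>xs. exp (theta G * path_cost G xs) *
        measure_pmf.expectation (next_state_law G i xs) (\<lambda>x. Lop2 G (\<pi> n xs x) (\<sigma> n xs x) h x))"
proof -
  have snoc: "exp (theta G * path_cost G (xs @ [t])) * measure_pmf.expectation (next_state_law G i (xs @ [t])) h =
      exp (theta G * path_cost G xs) * (case t of (x, a, b) \<Rightarrow> stage_payoff G h x a b)" for xs t
    by (cases t) (simp add: path_cost_def next_state_law_def stage_payoff_def distrib_left exp_add)
  have "exp_cost_terminal G \<pi> \<sigma> h i (Suc n) =
    measure_pmf.expectation (history_law G \<pi> \<sigma> i n)
      (\<lambda>xs. exp (theta G * path_cost G xs) *
        measure_pmf.expectation (next_triple_law G \<pi> \<sigma> i xs) (\<lambda>(x, a, b). stage_payoff G h x a b))"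
    by (simp add: exp_cost_terminal_def expectation_bind_finite finite_history_law snoc)
  also have "\<dots> = measure_pmf.expectation (history_law G \<pi> \<sigma> i n)
      (\<lambda>xs. exp (theta G * path_cost G xs) *
        measure_pmf.expectation (next_state_law G i xs) (\<lambda>x. Lop2 G (\<pi> n xs x) (\<sigma> n xs x) h x))"
    using expectation_next_triple[OF assms history_admissible[OF assms]]
    by (intro integral_cong_AE) (fastforce simp: AE_measure_pmf_iff dest: length_history)+
  finally show ?thesis .
qed

lemma expectation_mono_finite:
  fixes f g :: "'u \<Rightarrow> real"
  assumes "finite (set_pmf p)" "\<And>x. x \<in> set_pmf p \<Longrightarrow> f x \<le> g x"
  shows "measure_pmf.expectation p f \<le> measure_pmf.expectation p g"
  using assms by (intro integral_mono_AE integrable_measure_pmf_finite) (auto simp: AE_measure_pmf_iff)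

lemma exp_cost_terminal_le:
  assumes pol: "\<pi> \<in> policies1 G" "\<sigma> \<in> policies2 G" and K: "0 \<le> K"
    and step: "\<And>n xs x. (xs, x) \<in> histories G n \<Longrightarrow> Lop2 G (\<pi> n xs x) (\<sigma> n xs x) h x \<le> K * h x"
  shows "exp_cost_terminal G \<pi> \<sigma> h i n \<le> K ^ n * h i"
proof (induction n)
  case 0
  then show ?case by (simp add: exp_cost_terminal_0)
next
  case (Suc n)
  have "exp_cost_terminal G \<pi> \<sigma> h i (Suc n) \<le>
    measure_pmf.expectation (history_law G \<pi> \<sigma> i n)
      (\<lambda>xs. exp (theta G * path_cost G xs) * measure_pmf.expectation (next_state_law G i xs) (\<lambda>x. K * h x))"
    unfolding exp_cost_terminal_Suc[OF pol]
    using history_admissible[OF pol] length_history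
    by (intro expectation_mono_finite mult_left_mono finite_history_law step)
       (fastforce simp: histories_def)+
  also have "\<dots> = K * exp_cost_terminal G \<pi> \<sigma> h i n"
    by (simp add: exp_cost_terminal_def mult.left_commute)
  also have "\<dots> \<le> K * (K ^ n * h i)" using Suc.IH K by (rule mult_left_mono)
  finally show ?case by (simp add: mult.assoc)
qed

lemma exp_cost_terminal_ge:
  assumes pol: "\<pi> \<in> policies1 G" "\<sigma> \<in> policies2 G" and K: "0 \<le> K"
    and step: "\<And>n xs x. (xs, x) \<in> histories G n \<Longrightarrow> K * h x \<le> Lop2 G (\<pi> n xs x) (\<sigma> n xs x) h x"
  shows "K ^ n * h i \<le> exp_cost_terminal G \<pi> \<sigma> h i n"
proof (induction n)
  case 0
  then show ?case by (simp add: exp_cost_terminal_0)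
next
  case (Suc n)
  have "K * (K ^ n * h i) \<le> K * exp_cost_terminal G \<pi> \<sigma> h i n"
    using Suc.IH K by (rule mult_left_mono)
  also have "\<dots> = measure_pmf.expectation (history_law G \<pi> \<sigma> i n)
      (\<lambda>xs. exp (theta G * path_cost G xs) * measure_pmf.expectation (next_state_law G i xs) (\<lambda>x. K * h x))"
    by (simp add: exp_cost_terminal_def mult.left_commute)
  also have "\<dots> \<le> exp_cost_terminal G \<pi> \<sigma> h i (Suc n)"
    unfolding exp_cost_terminal_Suc[OF pol]
    using history_admissible[OF pol] length_history
    by (intro expectation_mono_finite mult_left_mono finite_history_law step)
       (fastforce simp: histories_def)+
  finally show ?case by (simp add: mult.assoc)
qed

lemma exp_cost_terminal_between:
  fixes G :: "('s::finite, 'a::finite, 'b::finite) rs_game"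
  shows "Min (range h) * exp_cost G \<pi> \<sigma> i n \<le> exp_cost_terminal G \<pi> \<sigma> h i n"
    and "exp_cost_terminal G \<pi> \<sigma> h i n \<le> Max (range h) * exp_cost G \<pi> \<sigma> i n"
proof -
  have *: "Min (range h) \<le> measure_pmf.expectation p h" "measure_pmf.expectation p h \<le> Max (range h)" for p
    unfolding expectation_finite_type
    by (rule probs_on_average_ge probs_on_average_le; simp add: probs_on_def)+
  show "Min (range h) * exp_cost G \<pi> \<sigma> i n \<le> exp_cost_terminal G \<pi> \<sigma> h i n"
    unfolding exp_cost_terminal_def exp_cost_def integral_mult_right_zero[symmetric]
    by (intro expectation_mono_finite finite_history_law) (simp add: mult.commute *)
  show "exp_cost_terminal G \<pi> \<sigma> h i n \<le> Max (range h) * exp_cost G \<pi> \<sigma> i n"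
    unfolding exp_cost_terminal_def exp_cost_def integral_mult_right_zero[symmetric]
    by (intro expectation_mono_finite finite_history_law) (simp add: mult.commute *)
qed

text \<open>
  Positivity of the expectations makes their logarithms monotone.
\<close>

lemma exp_cost_pos:
  assumes G: "valid_game G" and pol: "\<pi> \<in> policies1 G" "\<sigma> \<in> policies2 G"
  shows "0 < exp_cost G \<pi> \<sigma> i n"
proof -
  have "1 \<le> exp (theta G * path_cost G xs)" if "set xs \<subseteq> adm G" for xs
  proof -
    have "0 \<le> path_cost G xs"
      unfolding path_cost_def using G that by (intro sum_list_nonneg) (auto simp: valid_game_def)
    then show ?thesis using G by (simp add: valid_game_def)
  qed
  then have "1 \<le> exp_cost G \<pi> \<sigma> i n"
    unfolding exp_cost_def using history_admissible[OF pol]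
    by (intro measure_pmf.integral_ge_const integrable_measure_pmf_finite finite_history_law)
       (auto simp: AE_measure_pmf_iff)
  then show ?thesis by simp
qed

lemma normalized_log_growth:
  assumes "0 < \<theta>" "0 < K" "0 < C"
  shows "(\<lambda>n. ereal (1 / (\<theta> * real n) * ln (C * K ^ n))) \<longlonglongrightarrow> ereal (ln K / \<theta>)"
proof -
  have "(\<lambda>n. ln C / \<theta> * inverse (real n) + ln K / \<theta>) \<longlonglongrightarrow> ln C / \<theta> * 0 + ln K / \<theta>"
    by (intro tendsto_intros lim_inverse_n)
  moreover have "eventually (\<lambda>n. ln C / \<theta> * inverse (real n) + ln K / \<theta> = 1 / (\<theta> * real n) * ln (C * K ^ n)) sequentially"
    using eventually_gt_at_top[of 0]
  proof eventually_elim
    case (elim n)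
    then show ?case using assms by (simp add: ln_mult ln_realpow field_simps)
  qed
  ultimately have "(\<lambda>n. 1 / (\<theta> * real n) * ln (C * K ^ n)) \<longlonglongrightarrow> ln K / \<theta>"
    by (auto elim: Lim_transform_eventually)
  then show ?thesis by simp
qed

text \<open>
  The step hypothesis bounds the expected cost with terminal factor \<open>h\<close> by \<open>K ^ n * h i\<close>; dropping
  the terminal factor costs only the constant \<open>1 / Min (range h)\<close>, which is lost
  in the normalized logarithm.
\<close>

lemma J_crit_le:
  assumes G: "valid_game G" and pol: "\<pi> \<in> policies1 G" "\<sigma> \<in> policies2 G"
    and h: "\<And>x. 0 < h x" and K: "0 < K"
    and step: "\<And>n xs x. (xs, x) \<in> histories G n \<Longrightarrow> Lop2 G (\<pi> n xs x) (\<sigma> n xs x) h x \<le> K * h x"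
  shows "J_crit G i \<pi> \<sigma> \<le> ereal (ln K / theta G)"
proof -
  have \<theta>: "0 < theta G" using G by (simp add: valid_game_def)
  have m: "0 < Min (range h)" using h by simp
  have "exp_cost G \<pi> \<sigma> i n \<le> (h i / Min (range h)) * K ^ n" for n
  proof -
    have "Min (range h) * exp_cost G \<pi> \<sigma> i n \<le> K ^ n * h i"
      using exp_cost_terminal_between(1) exp_cost_terminal_le[OF pol _ step] K
      by (meson less_imp_le order_trans)
    then show ?thesis using m by (simp add: field_simps)
  qed
  then have "ln (exp_cost G \<pi> \<sigma> i n) \<le> ln ((h i / Min (range h)) * K ^ n)" for n
    using exp_cost_pos[OF G pol] by (meson ln_mono order_less_le_trans)
  then have "1 / (theta G * real n) * ln (exp_cost G \<pi> \<sigma> i n) \<le>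
      1 / (theta G * real n) * ln ((h i / Min (range h)) * K ^ n)" for n
    using \<theta> by (intro mult_left_mono) auto
  then have "J_crit G i \<pi> \<sigma> \<le>
      limsup (\<lambda>n. ereal (1 / (theta G * real n) * ln ((h i / Min (range h)) * K ^ n)))"
    unfolding J_crit_eq by (intro Limsup_mono always_eventually) simp
  also have "\<dots> = ereal (ln K / theta G)"
    using h m K \<theta> by (intro lim_imp_Limsup normalized_log_growth) auto
  finally show ?thesis .
qed

text \<open>
  As in the upper bound, with \<open>1 / Max (range h)\<close> as the constant.
\<close>

lemma J_crit_ge:
  assumes G: "valid_game G" and pol: "\<pi> \<in> policies1 G" "\<sigma> \<in> policies2 G"
    and h: "\<And>x. 0 < h x" and K: "0 < K"
    and step: "\<And>n xs x. (xs, x) \<in> histories G n \<Longrightarrow> K * h x \<le> Lop2 G (\<pi> n xs x) (\<sigma> n xs x) h x"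
  shows "ereal (ln K / theta G) \<le> J_crit G i \<pi> \<sigma>"
proof -
  have \<theta>: "0 < theta G" using G by (simp add: valid_game_def)
  have M: "0 < Max (range h)" using h[of i] by (subst Max_gr_iff) auto
  have "(h i / Max (range h)) * K ^ n \<le> exp_cost G \<pi> \<sigma> i n" for n
  proof -
    have "K ^ n * h i \<le> Max (range h) * exp_cost G \<pi> \<sigma> i n"
      using exp_cost_terminal_between(2) exp_cost_terminal_ge[OF pol _ step] K
      by (meson less_imp_le order_trans)
    then show ?thesis using M by (simp add: field_simps)
  qed
  moreover have "0 < (h i / Max (range h)) * K ^ n" for n
    using h K M by simp
  ultimately have "ln ((h i / Max (range h)) * K ^ n) \<le> ln (exp_cost G \<pi> \<sigma> i n)" for n
    by (meson ln_mono order_less_le_trans)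
  then have "1 / (theta G * real n) * ln ((h i / Max (range h)) * K ^ n) \<le>
      1 / (theta G * real n) * ln (exp_cost G \<pi> \<sigma> i n)" for n
    using \<theta> by (intro mult_left_mono) auto
  then have "limsup (\<lambda>n. ereal (1 / (theta G * real n) * ln ((h i / Max (range h)) * K ^ n))) \<le> J_crit G i \<pi> \<sigma>"
    unfolding J_crit_eq by (intro Limsup_mono always_eventually) simp
  moreover have "limsup (\<lambda>n. ereal (1 / (theta G * real n) * ln ((h i / Max (range h)) * K ^ n))) =
      ereal (ln K / theta G)"
    using h M K \<theta> by (intro lim_imp_Limsup normalized_log_growth) auto
  ultimately show ?thesis by simp
qed

lemma stationary_mem_policies: "\<phi> \<in> stationary_kernels U \<Longrightarrow> stationary \<phi> \<in> policies G U"
  by (auto simp: stationary_kernels_def stationary_def policies_def probs_on_def)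

lemma policy_in_probs_on:
  "\<pi> \<in> policies G U \<Longrightarrow> (xs, x) \<in> histories G n \<Longrightarrow> \<pi> n xs x \<in> probs_on (U x)"
  by (fastforce simp: policies_def probs_on_def)

lemma stationary_guarantee1:
  assumes G: "valid_game G" and h: "\<And>x. 0 < h x" and K: "0 < K"
    and \<phi>: "\<phi> \<in> stationary_kernels (acts1 G)"
    and step: "\<And>x \<nu>. \<nu> \<in> probs_on (acts2 G x) \<Longrightarrow> Lop2 G (\<phi> x) \<nu> h x \<le> K * h x"
    and \<sigma>: "\<sigma> \<in> policies2 G"
  shows "J_crit G i (stationary \<phi>) \<sigma> \<le> ereal (ln K / theta G)"
  by (rule J_crit_le[where h=h, OF G stationary_mem_policies[OF \<phi>] \<sigma> h K])
     (simp add: stationary_def step policy_in_probs_on[OF \<sigma>])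

lemma stationary_guarantee2:
  assumes G: "valid_game G" and h: "\<And>x. 0 < h x" and K: "0 < K"
    and \<psi>: "\<psi> \<in> stationary_kernels (acts2 G)"
    and step: "\<And>x \<mu>. \<mu> \<in> probs_on (acts1 G x) \<Longrightarrow> K * h x \<le> Lop2 G \<mu> (\<psi> x) h x"
    and \<pi>: "\<pi> \<in> policies1 G"
  shows "ereal (ln K / theta G) \<le> J_crit G i \<pi> (stationary \<psi>)"
  by (rule J_crit_ge[where h=h, OF G \<pi> stationary_mem_policies[OF \<psi>] h K])
     (simp add: stationary_def step policy_in_probs_on[OF \<pi>])

section \<open>The value and approximate saddle points\<close>

text \<open>
  Optimal mixtures in the matrix games of \<open>h\<close> give both players stationary policies which
  guarantee \<open>ln K / theta\<close>, so the upper value is at most this number and the lower value at least;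
  the lower value never exceeds the upper one.
\<close>

lemma eigenfunction_value:
  assumes G: "valid_game G" and h: "\<And>x. 0 < h x" and K: "0 < K"
    and eig: "\<And>x. Lop G h x = K * h x"
  shows "is_value G (\<lambda>_. ereal (ln K / theta G))"
proof -
  obtain \<phi> where \<phi>: "\<And>x. \<phi> x \<in> probs_on (acts1 G x)"
      "\<And>x \<nu>. \<nu> \<in> probs_on (acts2 G x) \<Longrightarrow> Lop2 G (\<phi> x) \<nu> h x \<le> K * h x"
    using exists_optimal_mixture1[OF G, of _ h] unfolding eig by metis
  obtain \<psi> where \<psi>: "\<And>x. \<psi> x \<in> probs_on (acts2 G x)"
      "\<And>x \<mu>. \<mu> \<in> probs_on (acts1 G x) \<Longrightarrow> K * h x \<le> Lop2 G \<mu> (\<psi> x) h x"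
    using exists_optimal_mixture2[OF G, of _ h] unfolding eig by metis
  have \<phi>k: "\<phi> \<in> stationary_kernels (acts1 G)" and \<psi>k: "\<psi> \<in> stationary_kernels (acts2 G)"
    using \<phi>(1) \<psi>(1) by (simp_all add: stationary_kernels_def)
  show ?thesis
    unfolding is_value_def
  proof
    fix i
    have "upper_value G i \<le> (SUP \<sigma>\<in>policies2 G. J_crit G i (stationary \<phi>) \<sigma>)"
      unfolding upper_value_def by (rule INF_lower[OF stationary_mem_policies[OF \<phi>k]])
    also have "\<dots> \<le> ereal (ln K / theta G)"
      by (rule SUP_least) (rule stationary_guarantee1[OF G h K \<phi>k \<phi>(2)])
    finally have upper: "upper_value G i \<le> ereal (ln K / theta G)" .
    have "ereal (ln K / theta G) \<le> (INF \<pi>\<in>policies1 G. J_crit G i \<pi> (stationary \<psi>))"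
      by (rule INF_greatest) (rule stationary_guarantee2[OF G h K \<psi>k \<psi>(2)])
    also have "\<dots> \<le> lower_value G i"
      unfolding lower_value_def by (rule SUP_upper[OF stationary_mem_policies[OF \<psi>k]])
    finally have lower: "ereal (ln K / theta G) \<le> lower_value G i" .
    have "lower_value G i \<le> upper_value G i"
      unfolding lower_value_def upper_value_def
    proof (intro SUP_least INF_greatest)
      fix \<sigma> \<pi> assume "\<sigma> \<in> policies2 G" "\<pi> \<in> policies1 G"
      then show "(INF \<pi>\<in>policies1 G. J_crit G i \<pi> \<sigma>) \<le> (SUP \<sigma>\<in>policies2 G. J_crit G i \<pi> \<sigma>)"
        by (meson INF_lower SUP_upper order_trans)
    qed
    then show "upper_value G i = ereal (ln K / theta G) \<and> lower_value G i = ereal (ln K / theta G)"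
      using upper lower by auto
  qed
qed

theorem proposition4p1:
  fixes G :: "('s::finite, 'a::finite, 'b::finite) rs_game"
    and hstar h :: "'s \<Rightarrow> real"
    and \<epsilon> :: real
    and \<phi> :: "'s \<Rightarrow> 'a pmf" and \<psi> :: "'s \<Rightarrow> 'b pmf"
  assumes "valid_game G"
    and "irreducibility_condition G"
    and "\<forall>i. 0 < hstar i"
    and "\<forall>i. lambda_star G * hstar i = Lop G hstar i"
    and "0 \<le> \<epsilon>"
    and "\<forall>i. h i \<le> hstar i \<and> hstar i \<le> exp (theta G * \<epsilon>) * h i"
    and "minimax_selector G h \<phi> \<psi>"
  shows "eps_saddle_point G \<epsilon> (stationary \<phi>) (stationary \<psi>)"
proof -
  note G = assms(1)
  let ?K = "lambda_star G" and ?e = "exp (theta G * \<epsilon>)"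
  have \<theta>: "0 < theta G" using G by (simp add: valid_game_def)
  have hstar: "0 < hstar x" and le: "h x \<le> hstar x" "hstar x \<le> ?e * h x"
    and eig: "Lop G hstar x = ?K * hstar x" for x
    using assms(3,4,6) by auto
  have h: "0 < h x" for x
    using less_le_trans[OF hstar[of x] le(2)] by (simp add: zero_less_mult_iff)
  \<comment> \<open>Any state serves; \<open>undefined\<close> is one.\<close>
  have \<lambda>: "0 < ?K"
    using Lop_pos[OF G, of hstar undefined] hstar
    by (simp add: eig zero_less_mult_iff) (metis less_asym)
  have \<phi>: "\<phi> \<in> stationary_kernels (acts1 G)" and \<psi>: "\<psi> \<in> stationary_kernels (acts2 G)"
    and sel1: "Lop G h x = (SUP \<nu>\<in>probs_on (acts2 G x). Lop2 G (\<phi> x) \<nu> h x)"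
    and sel2: "Lop G h x = (INF \<mu>\<in>probs_on (acts1 G x). Lop2 G \<mu> (\<psi> x) h x)" for x
    using assms(7) unfolding minimax_selector_def by blast+
  have step1: "Lop2 G (\<phi> x) \<nu> h x \<le> (?K * ?e) * h x" if "\<nu> \<in> probs_on (acts2 G x)" for x \<nu>
  proof -
    have "Lop2 G (\<phi> x) \<nu> h x \<le> Lop G h x"
      unfolding sel1 using \<phi> that by (intro Lop2_le_SUP) (auto simp: stationary_kernels_def)
    also have "\<dots> \<le> 1 * Lop G hstar x"
      using le(1) by (intro Lop_le_scaled[OF G]) auto
    also have "\<dots> \<le> ?K * (?e * h x)"
      using le(2) \<lambda> by (simp add: eig)
    finally show ?thesis by (simp add: mult.assoc)
  qed
  have step2: "(?K / ?e) * h x \<le> Lop2 G \<mu> (\<psi> x) h x" if "\<mu> \<in> probs_on (acts1 G x)" for x \<mu>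
  proof -
    have "?K * h x \<le> Lop G hstar x"
      using le(1) \<lambda> by (simp add: eig)
    also have "\<dots> \<le> ?e * Lop G h x"
      using le(2) by (intro Lop_le_scaled[OF G]) auto
    also have "\<dots> \<le> ?e * Lop2 G \<mu> (\<psi> x) h x"
      unfolding sel2 using \<psi> that
      by (intro mult_left_mono INF_le_Lop2) (auto simp: stationary_kernels_def)
    finally show ?thesis by (simp add: field_simps)
  qed
  have "ln (?K * ?e) / theta G = ln ?K / theta G + \<epsilon>" "ln (?K / ?e) / theta G = ln ?K / theta G - \<epsilon>"
    using \<lambda> \<theta> by (simp_all add: ln_mult ln_div field_simps)
  then show ?thesis
    unfolding eps_saddle_point_def
    using eigenfunction_value[OF G hstar \<lambda> eig] stationary_mem_policies[OF \<phi>] stationary_mem_policies[OF \<psi>]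
      stationary_guarantee1[OF G h _ \<phi> step1] stationary_guarantee2[OF G h _ \<psi> step2] \<lambda>
    by (auto intro!: exI[of _ "\<lambda>_. ereal (ln ?K / theta G)"])
qed

end
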